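(* For all integers $M\ge N\ge 0$ there exists a Markov kernel $\Lambda$ from $\{0,1,\dots,N\}$ to $\{0,1,\dots,M\}$ such that $D_N\Lambda=\Lambda L_M$ and such that $\Lambda$ is surjective as a linear map $f\mapsto\Lambda[f]$ from $\mathbb{R}^{\{0,\dots,M\}}$ to $\mathbb{R}^{\{0,\dots,N\}}$.
   Context: For an integer $N\ge 0$, the Ehrenfest generator $L_N$ is the $\{0,\dots,N\}\times\{0,\dots,N\}$ matrix whose off-diagonal entries are $L_N(x,x+1)=\frac{N-x}{2}$, $L_N(x,x-1)=\frac{x}{2}$, and $L_N(x,x')=0$ for $|x-x'|\ge 2$, and whose diagonal entries are such that all row sums vanish. The Yule (pure-death) generator $D_N$ is the $\{0,\dots,N\}\times\{0,\dots,N\}$ matrix with off-diagonal entries $D_N(x,x-1)=x$ and $D_N(x,x')=0$ for $x'\notin\{x,x-1\}$, and diagonal entries such that all row sums vanish. A Markov kernel from a finite set $W$ to a finite set $V$ is a $W\times V$ matrix with non-negative entries and all row sums equal to $1$; it acts on functions by $\Lambda[f](w)=\sum_{v\in V}\Lambda(w,v)f(v)$. *)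

theory Defs
  imports "Jordan_Normal_Form.Matrix"
begin

text \<open>
  Matrices indexed by \<open>{0,\<dots>,N} \<times> {0,\<dots>,N}\<close> are square matrices of dimension \<open>N + 1\<close>, and real
  functions on \<open>{0,\<dots>,N}\<close> are real vectors of dimension \<open>N + 1\<close>; a kernel then acts on functions
  by \<open>*\<^sub>v\<close>.
\<close>

text \<open>The diagonal values of the rate function \<open>q\<close> are ignored: the diagonal of the generator is
  the one that makes all row sums vanish.\<close>

definition generator_mat :: "nat \<Rightarrow> (nat \<Rightarrow> nat \<Rightarrow> real) \<Rightarrow> real mat" where
  "generator_mat N q = mat (N + 1) (N + 1)
     (\<lambda>(x, y). if x = y then - (\<Sum>z\<in>{0..N} - {x}. q x z) else q x y)"

definition ehrenfest_rate :: "nat \<Rightarrow> nat \<Rightarrow> nat \<Rightarrow> real" where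
  "ehrenfest_rate N x y =
     (if y = x + 1 then (real N - real x) / 2
      else if x = y + 1 then real x / 2
      else 0)"

definition ehrenfest_generator :: "nat \<Rightarrow> real mat" where
  "ehrenfest_generator N = generator_mat N (ehrenfest_rate N)"

definition yule_rate :: "nat \<Rightarrow> nat \<Rightarrow> real" where
  "yule_rate x y = (if x = y + 1 then real x else 0)"

definition yule_generator :: "nat \<Rightarrow> real mat" where
  "yule_generator N = generator_mat N yule_rate"

definition markov_kernel :: "nat \<Rightarrow> nat \<Rightarrow> real mat \<Rightarrow> bool" where
  "markov_kernel N M K \<longleftrightarrow>
     K \<in> carrier_mat (N + 1) (M + 1) \<and>
     (\<forall>w\<in>{0..N}. \<forall>v\<in>{0..M}. K $$ (w, v) \<ge> 0) \<and>
     (\<forall>w\<in>{0..N}. (\<Sum>v\<in>{0..M}. K $$ (w, v)) = 1)"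

end

theory Submission imports Defs begin

text \<open>
  Take row \<open>w\<close> of the kernel to be the binomial law with parameters \<open>M - w\<close> and \<open>1/2\<close>. On generating
  functions \<open>p\<close> of measures on \<open>{0,\<dots>,M}\<close>, the Ehrenfest generator acts (from the right) as
  \<open>p \<mapsto> (s - 1) / 2 * (M * p - (1 + s) * p')\<close>, with eigenfunctions \<open>(1 - s)^k * (1 + s)^(M - k)\<close> for
  the eigenvalues \<open>-k\<close>. The intertwining relation forces row \<open>w\<close> to have a generating function
  \<open>\<Sum>k. b k * (w choose k) * (1 - s)^k * (1 + s)^(M - k)\<close>, and for \<open>b k = 2 powi (-M)\<close>
  this is \<open>((1 + s) / 2)^(M - w)\<close>. Rows of distinct degrees are linearly independent, whence surjectivity.
\<close>

text \<open>The rates out of \<open>x\<close> add up to \<open>N / 2\<close> whatever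
  \<open>x\<close> is: the jumps that would leave \<open>{0..N}\<close> have rate 0. A sum of
  indicators lets \<open>sum.delta\<close> collapse matrix products.\<close>

lemma ehrenfest_generator_index:
  assumes "x \<le> N" "y \<le> N"
  shows "ehrenfest_generator N $$ (x, y) =
    (if x = y then - real N / 2 else 0) +
    (if y = x + 1 then (real N - real x) / 2 else 0) +
    (if x = y + 1 then real x / 2 else 0)"
proof -
  have "(\<Sum>z\<in>{0..N} - {x}. ehrenfest_rate N x z) = (\<Sum>z\<in>{0..N}. ehrenfest_rate N x z)"
    by (rule sum.mono_neutral_left) (auto simp: ehrenfest_rate_def)
  also have "\<dots> = (\<Sum>z\<in>{0..N}. (if z = x + 1 then (real N - real x) / 2 else 0) +
      (if z = x - 1 then real x / 2 else 0))"
    by (rule sum.cong) (auto simp: ehrenfest_rate_def)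
  also have "\<dots> = real N / 2"
    using assms by (auto simp: sum.distrib field_simps)
  finally show ?thesis
    using assms
    by (cases "x = y") (simp_all add: ehrenfest_generator_def generator_mat_def ehrenfest_rate_def[of N x y])
qed

text \<open>At \<open>x = 0\<close> the truncated \<open>x - 1\<close> makes both indicators refer
  to the diagonal, but both values are then 0.\<close>

lemma yule_generator_index:
  assumes "x \<le> N" "y \<le> N"
  shows "yule_generator N $$ (x, y) =
    (if y = x then - real x else 0) + (if y = x - 1 then real x else 0)"
proof -
  have "(\<Sum>z\<in>{0..N} - {x}. yule_rate x z) = (\<Sum>z\<in>{0..N}. yule_rate x z)"
    by (rule sum.mono_neutral_left) (auto simp: yule_rate_def)
  also have "\<dots> = (\<Sum>z\<in>{0..N}. if z = x - 1 then real x else 0)"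
    by (rule sum.cong) (auto simp: yule_rate_def)
  also have "\<dots> = real x"
    using assms by auto
  finally show ?thesis
    using assms by (auto simp: yule_generator_def generator_mat_def yule_rate_def)
qed

lemma generator_mat_carrier: "generator_mat N q \<in> carrier_mat (N + 1) (N + 1)"
  by (simp add: generator_mat_def)

definition binomial_kernel :: "nat \<Rightarrow> nat \<Rightarrow> real mat" where
  "binomial_kernel N M =
     mat (N + 1) (M + 1) (\<lambda>(w, v). real ((M - w) choose v) / 2 ^ (M - w))"

lemma binomial_kernel_carrier: "binomial_kernel N M \<in> carrier_mat (N + 1) (M + 1)"
  by (simp add: binomial_kernel_def)

lemma binomial_kernel_index:
  "w \<le> N \<Longrightarrow> v \<le> M \<Longrightarrow>
    binomial_kernel N M $$ (w, v) = real ((M - w) choose v) / 2 ^ (M - w)"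
  by (simp add: binomial_kernel_def)

text \<open>Binomials vanish beyond \<open>n\<close>; this cuts a row over \<open>{0..M}\<close>
  down to its support \<open>{0..M - w}\<close>.\<close>

lemma sum_choose_mult_extend:
  fixes f :: "nat \<Rightarrow> real"
  assumes "n \<le> m"
  shows "(\<Sum>v\<le>m. real (n choose v) * f v) = (\<Sum>v\<le>n. real (n choose v) * f v)"
  using assms by (intro sum.mono_neutral_right) auto

lemma markov_kernel_binomial_kernel: "markov_kernel N M (binomial_kernel N M)"
proof -
  have "(\<Sum>v\<in>{0..M}. binomial_kernel N M $$ (w, v)) = 1" if "w \<le> N" for w
  proof -
    have "(\<Sum>v\<in>{0..M}. binomial_kernel N M $$ (w, v)) =
        (\<Sum>v\<le>M. real ((M - w) choose v) * 1) / 2 ^ (M - w)"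
      using that by (simp add: binomial_kernel_index sum_divide_distrib atMost_atLeast0)
    also have "(\<Sum>v\<le>M. real ((M - w) choose v) * 1) = real (\<Sum>v\<le>M - w. (M - w) choose v)"
      by (subst sum_choose_mult_extend) auto
    finally show ?thesis
      by (simp add: choose_row_sum)
  qed
  then show ?thesis
    using binomial_kernel_carrier[of N M] by (auto simp: markov_kernel_def binomial_kernel_index)
qed

text \<open>Both sides equal \<open>n * (n - 1 choose k)\<close> by absorption, and vanish for
  \<open>k > n\<close>. It expresses the neighbours of \<open>n choose v\<close> through
  \<open>n choose v\<close> itself.\<close>

lemma choose_Suc_mult: "real (Suc k) * real (n choose Suc k) = (real n - real k) * real (n choose k)"
proof (cases "k \<le> n")
  case True
  have "Suc k * (n choose Suc k) = (n - k) * (n choose k)"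
    by (rule trans[OF binomial_absorption binomial_absorb_comp[symmetric]])
  then show ?thesis
    using True by (metis of_nat_diff of_nat_mult)
qed (simp add: binomial_eq_0)

lemma yule_mult_binomial_kernel_index:
  assumes "w \<le> N" "v \<le> M"
  shows "(yule_generator N * binomial_kernel N M) $$ (w, v) =
    real w * (binomial_kernel N M $$ (w - 1, v) - binomial_kernel N M $$ (w, v))"
proof -
  let ?K = "binomial_kernel N M"
  have "(yule_generator N * ?K) $$ (w, v) =
      (\<Sum>z\<in>{0..<N + 1}. yule_generator N $$ (w, z) * ?K $$ (z, v))"
    using assms binomial_kernel_carrier[of N M]
      generator_mat_carrier[of N yule_rate, folded yule_generator_def]
    by (simp add: scalar_prod_def)
  also have "\<dots> = (\<Sum>z\<in>{0..<N + 1}. (if z = w then - real w * ?K $$ (z, v) else 0) +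
      (if z = w - 1 then real w * ?K $$ (z, v) else 0))"
    using assms by (intro sum.cong) (auto simp: yule_generator_index algebra_simps)
  also have "\<dots> = real w * (?K $$ (w - 1, v) - ?K $$ (w, v))"
    unfolding sum.distrib using assms by (auto simp: algebra_simps)
  finally show ?thesis .
qed

lemma binomial_kernel_mult_ehrenfest_index:
  assumes "w \<le> N" "v \<le> M" "N \<le> M"
  shows "(binomial_kernel N M * ehrenfest_generator M) $$ (w, v) =
    ((if v = 0 then 0 else real ((M - w) choose (v - 1)) * (real M - real v + 1)) +
     real (v + 1) * real ((M - w) choose (v + 1)) - real M * real ((M - w) choose v)) / 2 / 2 ^ (M - w)"
proof -
  let ?K = "binomial_kernel N M" and ?c = "\<lambda>z. real ((M - w) choose z) / 2 ^ (M - w)"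
  have "(?K * ehrenfest_generator M) $$ (w, v) =
      (\<Sum>z\<in>{0..<M + 1}. ?K $$ (w, z) * ehrenfest_generator M $$ (z, v))"
    using assms binomial_kernel_carrier[of N M]
      generator_mat_carrier[of M "ehrenfest_rate M", folded ehrenfest_generator_def]
    by (simp add: scalar_prod_def)
  \<comment> \<open>The test \<open>v = 0\<close> is needed because \<open>v - 1\<close> truncates
    to 0, which would add a spurious upward jump into 0.\<close>
  also have "\<dots> = (\<Sum>z\<in>{0..<M + 1}. (if z = v then - ?c z * real M / 2 else 0) +
      (if z = v - 1 then (if v = 0 then 0 else ?c z * (real M - real z) / 2) else 0) +
      (if z = v + 1 then ?c z * real z / 2 else 0))"
    using assms
    by (intro sum.cong) (auto simp: ehrenfest_generator_index binomial_kernel_index)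
  also have "\<dots> = - ?c v * real M / 2 + (if v = 0 then 0 else ?c (v - 1) * (real M - real (v - 1)) / 2) +
      (if v + 1 \<in> {0..<M + 1} then ?c (v + 1) * real (v + 1) / 2 else 0)"
    unfolding sum.distrib using assms by (simp only: sum.delta finite_atLeastLessThan) auto
  \<comment> \<open>The range test fails only for \<open>v = M\<close>, where
    \<open>(M - w) choose (M + 1)\<close> is 0 anyway.\<close>
  also have "(if v + 1 \<in> {0..<M + 1} then ?c (v + 1) * real (v + 1) / 2 else 0) =
      ?c (v + 1) * real (v + 1) / 2"
    using assms by auto
  also have "- ?c v * real M / 2 + (if v = 0 then 0 else ?c (v - 1) * (real M - real (v - 1)) / 2) +
      ?c (v + 1) * real (v + 1) / 2 =
    ((if v = 0 then 0 else real ((M - w) choose (v - 1)) * (real M - real v + 1)) +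
     real (v + 1) * real ((M - w) choose (v + 1)) - real M * real ((M - w) choose v)) / 2 / 2 ^ (M - w)"
    by (auto simp: divide_simps Suc_le_eq)
  finally show ?thesis .
qed

text \<open>Entrywise, with \<open>n = M - w\<close>: Pascal's rule turns the difference of rows
  \<open>w - 1\<close> and \<open>w\<close> into binomials of order \<open>n\<close>. On the other
  side absorption removes the neighbours of \<open>v\<close>, and \<open>M = n + w\<close> leaves
  the same multiple of \<open>w\<close>.\<close>

lemma binomial_kernel_intertwining:
  assumes "N \<le> M"
  shows "yule_generator N * binomial_kernel N M = binomial_kernel N M * ehrenfest_generator M"
proof (rule eq_matI)
  show "dim_row (yule_generator N * binomial_kernel N M) = dim_row (binomial_kernel N M * ehrenfest_generator M)"
    "dim_col (yule_generator N * binomial_kernel N M) = dim_col (binomial_kernel N M * ehrenfest_generator M)"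
    by (simp_all add: yule_generator_def ehrenfest_generator_def generator_mat_def binomial_kernel_def)
next
  fix w v
  assume "w < dim_row (binomial_kernel N M * ehrenfest_generator M)"
    "v < dim_col (binomial_kernel N M * ehrenfest_generator M)"
  then have w: "w \<le> N" and v: "v \<le> M"
    by (simp_all add: ehrenfest_generator_def generator_mat_def binomial_kernel_def)
  define n where "n = M - w"
  have M: "real M = real n + real w"
    using w assms by (simp add: n_def)
  let ?p = "if v = 0 then 0 else real (n choose (v - 1))"
  have up: "real (v + 1) * real (n choose (v + 1)) = (real n - real v) * real (n choose v)"
    using choose_Suc_mult[of v n] by simp
  have down: "(real n - real v + 1) * ?p = real v * real (n choose v)"
    using choose_Suc_mult[of "v - 1" n] by (cases v) auto
  have pascal: "real (Suc n choose v) = real (n choose v) + ?p"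
    by (cases v) auto
  have "(yule_generator N * binomial_kernel N M) $$ (w, v) =
      real w * (real (Suc n choose v) / 2 ^ Suc n - real (n choose v) / 2 ^ n)"
  \<comment> \<open>For \<open>w = 0\<close> the factor \<open>real w\<close> kills both sides, so
    the truncated row index \<open>w - 1\<close> is harmless.\<close>
  proof (cases "w = 0")
    case False
    then have "M - (w - 1) = Suc n"
      using w assms by (simp add: n_def)
    then show ?thesis
      using w v unfolding yule_mult_binomial_kernel_index[OF w v]
      by (simp add: binomial_kernel_index n_def)
  qed (use w v in \<open>simp add: yule_mult_binomial_kernel_index\<close>)
  also have "\<dots> = real w * (?p - real (n choose v)) / 2 / 2 ^ n"
    unfolding pascal by (simp add: field_simps)
  also have "real w * (?p - real (n choose v)) =
      ?p * (real M - real v + 1) + real (v + 1) * real (n choose (v + 1)) - real M * real (n choose v)"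
    unfolding up M using down by (simp only: algebra_simps)
  also have "?p * (real M - real v + 1) = (if v = 0 then 0 else real (n choose (v - 1)) * (real M - real v + 1))"
    by simp
  finally show "(yule_generator N * binomial_kernel N M) $$ (w, v) =
      (binomial_kernel N M * ehrenfest_generator M) $$ (w, v)"
    unfolding binomial_kernel_mult_ehrenfest_index[OF w v assms] n_def .
qed

text \<open>The system is triangular with diagonal entries \<open>n choose n = 1\<close>, so it can
  be solved for \<open>f 0\<close>, \<open>f 1\<close>, ... in turn.\<close>

lemma binomial_transform_surj:
  fixes h :: "nat \<Rightarrow> real"
  shows "\<exists>f. \<forall>n\<le>m. (\<Sum>v\<le>n. real (n choose v) * f v) = h n"
proof (induction m)
  case 0
  show ?case by (rule exI[of _ h]) simp
next
  case (Suc m)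
  then obtain f where f: "\<forall>n\<le>m. (\<Sum>v\<le>n. real (n choose v) * f v) = h n" by blast
  \<comment> \<open>The equations up to \<open>m\<close> do not see the value at
    \<open>Suc m\<close>, which is chosen to satisfy the next one.\<close>
  define g where "g = f(Suc m := h (Suc m) - (\<Sum>v\<le>m. real (Suc m choose v) * f v))"
  have same: "(\<Sum>v\<le>k. real (n choose v) * g v) = (\<Sum>v\<le>k. real (n choose v) * f v)" if "k \<le> m" for k n
    using that by (intro sum.cong) (auto simp: g_def)
  have "(\<Sum>v\<le>n. real (n choose v) * g v) = h n" if "n \<le> Suc m" for n
  proof (cases "n = Suc m")
    case True
    then show ?thesis
      using same[of m "Suc m"] by (simp add: g_def del: binomial_Suc_Suc)
  next
    case False
    then show ?thesis using that f same[of n n] by simp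
  qed
  then show ?case by blast
qed

lemma binomial_kernel_surj:
  assumes "N \<le> M"
  shows "(\<lambda>f. binomial_kernel N M *\<^sub>v f) ` carrier_vec (M + 1) = carrier_vec (N + 1)"
proof (intro equalityI subsetI)
  fix g :: "real vec"
  assume g: "g \<in> carrier_vec (N + 1)"
  \<comment> \<open>Equation \<open>n = M - w\<close> is row \<open>w\<close> multiplied by
    \<open>2 ^ n\<close>. For \<open>n < M - N\<close> the index \<open>M - n\<close> lies outside
    \<open>g\<close>; only the equations with \<open>w \<le> N\<close> are read off below.\<close>
  obtain f where f: "\<forall>n\<le>M. (\<Sum>v\<le>n. real (n choose v) * f v) = 2 ^ n * g $ (M - n)"
    using binomial_transform_surj[of M "\<lambda>n. 2 ^ n * g $ (M - n)"] by blast
  have "binomial_kernel N M *\<^sub>v vec (M + 1) f = g"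
  proof (rule eq_vecI)
    fix w
    assume "w < dim_vec g"
    then have w: "w \<le> N" using g by simp
    have "(binomial_kernel N M *\<^sub>v vec (M + 1) f) $ w = (\<Sum>v\<in>{0..<M + 1}. binomial_kernel N M $$ (w, v) * f v)"
      using w binomial_kernel_carrier[of N M] by (simp add: scalar_prod_def)
    also have "\<dots> = (\<Sum>v\<le>M. real ((M - w) choose v) * f v) / 2 ^ (M - w)"
      unfolding sum_divide_distrib using w by (intro sum.cong) (auto simp: binomial_kernel_index)
    also have "\<dots> = g $ w"
      using f[rule_format, of "M - w"] w assms by (subst sum_choose_mult_extend) simp_all
    finally show "(binomial_kernel N M *\<^sub>v vec (M + 1) f) $ w = g $ w" .
  qed (use g binomial_kernel_carrier[of N M] in simp)
  then show "g \<in> (\<lambda>f. binomial_kernel N M *\<^sub>v f) ` carrier_vec (M + 1)"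
    by (metis image_eqI vec_carrier)
qed (use binomial_kernel_carrier[of N M] in auto)

theorem mainTheorem4:
  fixes M N :: nat
  assumes "M \<ge> N"
  shows "\<exists>K :: real mat. markov_kernel N M K \<and>
           yule_generator N * K = K * ehrenfest_generator M \<and>
           (\<lambda>f. K *\<^sub>v f) ` carrier_vec (M + 1) = carrier_vec (N + 1)"
  using markov_kernel_binomial_kernel binomial_kernel_intertwining[OF assms]
    binomial_kernel_surj[OF assms] by blast

end
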